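(* Let $k\ge0$ and $n\in\{2^k,2^k+1\}$. Then for every integer $i\ge0$ with $2^i\le n$, the polynomial $1+x^{2^i}$ does not divide $\mathrm{num}_{\mathcal B}(n,x)$.
   Context: $\mathcal B(n)$ is the set of binary partitions of $n$ (all parts powers of $2$) and $m_\lambda(i)$ the number of parts of $\lambda$ equal to $i$. For $\lambda\in\mathcal B(n)$ let $h_{\mathcal B,\lambda}(x)=\prod_{i=0}^{\lfloor\log_2 n\rfloor}(1+x^{2^i})^{\lfloor n/2^i\rfloor-m_\lambda(2^i)}$ and $\mathrm{num}_{\mathcal B}(n,x)=\sum_{\lambda\in\mathcal B(n)}h_{\mathcal B,\lambda}(x)$. *)

theory Defs
  imports Complex_Main "HOL-Library.Multiset" "HOL-Computational_Algebra.Polynomial"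
begin

text \<open>A partition is represented by the multiset of its parts, so that the multiplicity
  $m_\mu(i)$ is \<^term>\<open>count \<mu> i\<close>. Polynomials have integer coefficients; since
  $1 + x^{2^i}$ is monic, divisibility by it in $Z[x]$ and in $Q[x]$ coincide.\<close>

definition binary_partitions :: "nat \<Rightarrow> nat multiset set" where
  "binary_partitions n = {\<mu>. (\<forall>p \<in># \<mu>. \<exists>j. p = 2 ^ j) \<and> sum_mset \<mu> = n}"

definition h_B :: "nat \<Rightarrow> nat multiset \<Rightarrow> int poly" where
  "h_B n \<mu> = (\<Prod>i = 0..nat \<lfloor>log 2 (real n)\<rfloor>.
     (1 + monom 1 (2 ^ i)) ^ (n div 2 ^ i - count \<mu> (2 ^ i)))"

definition num_B :: "nat \<Rightarrow> int poly" where
  "num_B n = (\<Sum>\<mu> \<in> binary_partitions n. h_B n \<mu>)"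

text \<open>The truncated subtraction in the exponents never truncates, and the sum ranges over
  a finite set.\<close>

lemma count_mult_le_sum_mset: "count M p * p \<le> sum_mset (M :: nat multiset)"
  by (induction M) auto

lemma count_binary_partition_le:
  assumes "\<mu> \<in> binary_partitions n"
  shows "count \<mu> (2 ^ i) \<le> n div 2 ^ i"
  using count_mult_le_sum_mset[of \<mu> "2 ^ i"] assms
  by (simp add: binary_partitions_def less_eq_div_iff_mult_less_eq)

lemma finite_binary_partitions: "finite (binary_partitions n)"
proof (rule finite_subset)
  show "binary_partitions n \<subseteq> mset ` {xs. set xs \<subseteq> {..n} \<and> length xs \<le> n}"
  proof
    fix M assume M: "M \<in> binary_partitions n"
    obtain xs where xs: "M = mset xs" by (metis ex_mset)
    have pos: "\<forall>p \<in> set xs. 1 \<le> p" and sum: "sum_list xs = n"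
      using M by (auto simp: binary_partitions_def xs sum_mset_sum_list)
    have "length xs \<le> sum_list xs"
      using pos by (induction xs) auto
    moreover have "set xs \<subseteq> {..n}"
      using sum member_le_sum_list[of _ xs] by auto
    ultimately show "M \<in> mset ` {xs. set xs \<subseteq> {..n} \<and> length xs \<le> n}"
      using xs sum by auto
  qed
  show "finite (mset ` {xs. set xs \<subseteq> {..n} \<and> length xs \<le> n})"
    by (intro finite_imageI finite_lists_length_le) simp
qed

end

theory Submission
  imports Defs
begin

text \<open>If a binary partition of $n$ has fewer than $\lfloor n/2^i\rfloor$ parts equal to $2^i$, its
  summand is divisible by $1+x^{2^i}$. For the given $n$ the remainder $n \bmod 2^i$ is at most
  $1$, so exactly one partition has the maximal number of parts $2^i$. Its summand is a
  product of powers of $1+x^{2^j}$ with $j\neq i$. Modulo $1+x^{2^i}$ each of these divides $2$,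
  because $1+y$ divides $(1+y^{2m})-2$; hence the product divides a power of $2$ modulo
  $1+x^{2^i}$, whereas $1+x^{2^i}$ divides no power of $2$.\<close>

lemma one_plus_dvd_even_power_minus_one:
  fixes y :: "'a::comm_ring_1"
  shows "1 + y dvd y ^ (2 * m) - 1"
proof -
  have "y ^ 2 - 1 dvd (y ^ 2) ^ m - 1"
    by (simp add: power_diff_1_eq)
  moreover have "y ^ 2 - 1 = (1 + y) * (y - 1)"
    by (simp add: algebra_simps power2_eq_square)
  ultimately show ?thesis
    by (metis dvd_mult_left power_mult)
qed

text \<open>For \<open>i < j\<close> the exponent \<open>2 ^ j\<close> is an even multiple of
  \<open>2 ^ i\<close>, so the previous lemma applies with \<open>y = monom 1 (2 ^ i)\<close>. Read
  as a congruence: the later factor is 2 modulo the earlier one.\<close>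

lemma one_plus_monom_dvd_minus_two:
  fixes i j :: nat
  assumes "i < j"
  shows "(1 + monom 1 (2 ^ i) :: 'a::comm_ring_1 poly) dvd (1 + monom 1 (2 ^ j)) - 2"
proof -
  define m :: nat where "m = 2 ^ (j - i - 1)"
  have "j = i + Suc (j - i - 1)"
    using assms by simp
  then have "(2::nat) ^ j = 2 ^ i * (2 * m)"
    unfolding m_def by (metis power_add power_Suc)
  then have "(monom 1 (2 ^ j) :: 'a poly) = monom 1 (2 ^ i) ^ (2 * m)"
    by (simp add: monom_power)
  then show ?thesis
    using one_plus_dvd_even_power_minus_one[of "monom 1 (2 ^ i) :: 'a poly" m]
    by (simp add: algebra_simps)
qed

text \<open>Says that \<open>p\<close> becomes a unit modulo \<open>a\<close> once \<open>2\<close> is inverted.\<close>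

definition dvd_two_power_mod :: "'a::comm_ring_1 \<Rightarrow> 'a \<Rightarrow> bool" where
  "dvd_two_power_mod a p \<longleftrightarrow> (\<exists>q m. a dvd p * q - 2 ^ m)"

lemma dvd_two_power_mod_one: "dvd_two_power_mod a 1"
  unfolding dvd_two_power_mod_def by (rule exI[of _ 1], rule exI[of _ 0]) simp

lemma dvd_two_power_mod_mult:
  assumes "dvd_two_power_mod a p" "dvd_two_power_mod a r"
  shows "dvd_two_power_mod a (p * r)"
proof -
  obtain q m q' m' where q: "a dvd p * q - 2 ^ m" and q': "a dvd r * q' - 2 ^ m'"
    using assms unfolding dvd_two_power_mod_def by blast
  have "(p * r) * (q * q') - 2 ^ (m + m') = (p * q - 2 ^ m) * (r * q') + 2 ^ m * (r * q' - 2 ^ m')"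
    by (simp add: algebra_simps power_add)
  then have "a dvd (p * r) * (q * q') - 2 ^ (m + m')"
    using q q' by simp
  then show ?thesis
    unfolding dvd_two_power_mod_def by blast
qed

lemma dvd_two_power_mod_power: "dvd_two_power_mod a p \<Longrightarrow> dvd_two_power_mod a (p ^ e)"
  by (induction e) (simp_all add: dvd_two_power_mod_one dvd_two_power_mod_mult)

lemma dvd_two_power_mod_prod:
  assumes "\<And>j. j \<in> J \<Longrightarrow> dvd_two_power_mod a (f j)"
  shows "dvd_two_power_mod a (\<Prod>j\<in>J. f j)"
  using assms
  by (induction J rule: infinite_finite_induct)
    (simp_all add: dvd_two_power_mod_one dvd_two_power_mod_mult)

text \<open>For \<open>i < j\<close> the second polynomial is congruent to 2 modulo the first, so
  \<open>q = 1\<close> and \<open>m = 1\<close> work. For \<open>j < i\<close> the same congruence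
  with the roles exchanged exhibits it as a divisor of -2 modulo the first.\<close>

lemma dvd_two_power_mod_one_plus_monom:
  fixes i j :: nat
  assumes "i \<noteq> j"
  shows "dvd_two_power_mod (1 + monom 1 (2 ^ i) :: 'a::comm_ring_1 poly) (1 + monom 1 (2 ^ j))"
proof (cases "i < j")
  case True
  then show ?thesis
    using one_plus_monom_dvd_minus_two[OF True, where ?'a = 'a] unfolding dvd_two_power_mod_def
    by (intro exI[of _ 1]) simp
next
  case False
  then obtain q :: "'a poly" where
    "(1 + monom 1 (2 ^ i)) - 2 = (1 + monom 1 (2 ^ j)) * q"
    using one_plus_monom_dvd_minus_two[of j i, where ?'a = 'a] assms by (auto elim: dvdE)
  then have "(1 + monom 1 (2 ^ j)) * (- q) - 2 ^ 1 = (1 + monom 1 (2 ^ i)) * (- 1)"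
    by (simp add: algebra_simps)
  then show ?thesis
    unfolding dvd_two_power_mod_def by (metis dvd_triv_left)
qed

lemma not_one_plus_monom_dvd_if_dvd_two_power_mod:
  fixes p :: "int poly"
  assumes "dvd_two_power_mod (1 + monom 1 d) p" and "0 < d"
  shows "\<not> (1 + monom 1 d) dvd p"
proof
  assume "(1 + monom 1 d) dvd p"
  moreover obtain q m where "(1 + monom 1 d) dvd p * q - 2 ^ m"
    using assms(1) unfolding dvd_two_power_mod_def by blast
  ultimately have "(1 + monom 1 d) dvd p * q - (p * q - 2 ^ m)"
    by (metis dvd_diff dvd_mult2)
  then have dvd: "(1 + monom 1 d :: int poly) dvd 2 ^ m"
    by simp
  have "degree (1 + monom 1 d :: int poly) = d"
    using assms(2) by (subst degree_add_eq_right) (simp_all add: degree_monom_eq)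
  moreover have "degree (2 ^ m :: int poly) = 0"
    using degree_power_le[of "2 :: int poly" m] by simp
  ultimately show False
    \<comment> \<open>Comparing degrees requires \<open>2 ^ m\<close> to be nonzero, which holds
      over the integers but not in characteristic 2.\<close>
    using dvd_imp_degree_le[OF dvd] assms(2) by simp
qed

lemma mset_pos_sum_le_one_eq:
  fixes M :: "nat multiset"
  assumes "\<forall>p \<in># M. 0 < p" and "sum_mset M \<le> 1"
  shows "M = replicate_mset (sum_mset M) 1"
  using assms by (induction M) (auto simp: add_is_1 le_Suc_eq)

text \<open>Once \<open>n div 2 ^ i\<close> parts \<open>2 ^ i\<close> are removed, positive parts
  with sum \<open>n mod 2 ^ i\<close> remain. As this sum is at most 1, they are forced.\<close>

lemma binary_partition_max_count_iff:
  assumes "n mod 2 ^ i \<le> 1"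
  shows "\<mu> \<in> binary_partitions n \<and> count \<mu> (2 ^ i) = n div 2 ^ i \<longleftrightarrow>
    \<mu> = replicate_mset (n div 2 ^ i) (2 ^ i) + replicate_mset (n mod 2 ^ i) 1"
    (is "?L \<longleftrightarrow> \<mu> = ?A + ?B")
proof
  assume L: ?L
  define \<rho> where "\<rho> = \<mu> - ?A"
  have "?A \<subseteq># \<mu>"
    using L by (simp flip: count_le_replicate_mset_subset_eq)
  then have \<mu>: "\<mu> = ?A + \<rho>"
    by (simp add: \<rho>_def)
  have sum: "sum_mset \<mu> = n" and parts: "\<forall>p \<in># \<mu>. \<exists>j. p = 2 ^ j"
    using L by (auto simp: binary_partitions_def)
  have "n div 2 ^ i * 2 ^ i + sum_mset \<rho> = n"
    using sum by (simp add: \<mu>)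
  then have "sum_mset \<rho> = n mod 2 ^ i"
    by (metis add_left_cancel div_mult_mod_eq)
  moreover have "\<forall>p \<in># \<rho>. 0 < p"
    using parts by (metis \<mu> union_iff zero_less_numeral zero_less_power)
  ultimately show "\<mu> = ?A + ?B"
    using mset_pos_sum_le_one_eq[of \<rho>] assms \<mu> by simp
next
  assume \<mu>: "\<mu> = ?A + ?B"
  have "\<exists>j. p = 2 ^ j" if "p \<in># \<mu>" for p
    using that by (auto simp: \<mu> in_replicate_mset split: if_splits intro: exI[of _ 0])
  \<comment> \<open>The parts 1 do not disturb the count of \<open>2 ^ i\<close>: for
    \<open>i = 0\<close> the remainder is 0 and there are none.\<close>
  then show ?L
    using div_mult_mod_eq[of n "2 ^ i"] by (auto simp: \<mu> binary_partitions_def)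
qed

lemma not_one_plus_monom_dvd_num_B:
  assumes "2 ^ i \<le> n" and "n mod 2 ^ i \<le> 1"
  shows "\<not> (1 + monom 1 (2 ^ i)) dvd num_B n"
proof -
  let ?a = "1 + monom 1 (2 ^ i) :: int poly"
  define \<mu>0 :: "nat multiset" where "\<mu>0 = replicate_mset (n div 2 ^ i) (2 ^ i) + replicate_mset (n mod 2 ^ i) 1"
  have \<mu>0: "\<mu>0 \<in> binary_partitions n" "count \<mu>0 (2 ^ i) = n div 2 ^ i"
    using binary_partition_max_count_iff[OF assms(2), of \<mu>0] by (simp_all add: \<mu>0_def)
  \<comment> \<open>The factor with index \<open>i\<close> must actually occur in the product
    \<open>h_B\<close>.\<close>
  have "real i \<le> log 2 (real n)"
    using assms(1) by (simp add: le_log_of_power)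
  then have i: "i \<in> {0..nat \<lfloor>log 2 (real n)\<rfloor>}"
    by (simp add: le_nat_iff le_floor_iff)
  have others: "?a dvd h_B n \<mu>" if "\<mu> \<in> binary_partitions n - {\<mu>0}" for \<mu>
  proof -
    have "count \<mu> (2 ^ i) \<noteq> n div 2 ^ i"
      using binary_partition_max_count_iff[OF assms(2), of \<mu>] that by (auto simp: \<mu>0_def)
    then have "0 < n div 2 ^ i - count \<mu> (2 ^ i)"
      using count_binary_partition_le[of \<mu> n i] that by simp
    then have "?a dvd ?a ^ (n div 2 ^ i - count \<mu> (2 ^ i))"
      by (simp add: dvd_power)
    also have "\<dots> dvd h_B n \<mu>"
      unfolding h_B_def by (rule dvd_prodI[OF _ i]) simp
    finally show ?thesis .
  qed
  have "dvd_two_power_mod ?a (h_B n \<mu>0)"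
    unfolding h_B_def
  proof (rule dvd_two_power_mod_prod)
    fix j
    show "dvd_two_power_mod ?a ((1 + monom 1 (2 ^ j)) ^ (n div 2 ^ j - count \<mu>0 (2 ^ j)))"
      \<comment> \<open>For \<open>j = i\<close> the exponent is 0 by maximality of the count, so
        the one bad factor becomes 1.\<close>
      by (cases "i = j") (use \<mu>0(2) in \<open>auto intro: dvd_two_power_mod_one
          dvd_two_power_mod_power dvd_two_power_mod_one_plus_monom\<close>)
  qed
  then have "\<not> ?a dvd h_B n \<mu>0"
    by (rule not_one_plus_monom_dvd_if_dvd_two_power_mod) simp
  moreover have "num_B n = h_B n \<mu>0 + (\<Sum>\<mu> \<in> binary_partitions n - {\<mu>0}. h_B n \<mu>)"
    unfolding num_B_def by (rule sum.remove[OF finite_binary_partitions \<mu>0(1)])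
  moreover have "?a dvd (\<Sum>\<mu> \<in> binary_partitions n - {\<mu>0}. h_B n \<mu>)"
    by (rule dvd_sum) (rule others)
  ultimately show ?thesis
    by (simp add: dvd_add_left_iff)
qed

theorem theorem4p18:
  fixes k n i :: nat
  assumes "n \<in> {2 ^ k, 2 ^ k + 1}"
    and "2 ^ i \<le> n"
  shows "\<not> (1 + monom 1 (2 ^ i)) dvd num_B n"
proof -
  have "n mod 2 ^ i \<le> 1"
  proof (cases "i \<le> k")
    case True
    then have "(2::nat) ^ i dvd 2 ^ k"
      by (rule le_imp_power_dvd)
    then obtain c where "(2::nat) ^ k = 2 ^ i * c" ..
    then have "n mod 2 ^ i = 0 \<or> n mod 2 ^ i = 1 mod 2 ^ i"
      using assms(1) by (metis empty_iff insert_iff mod_mult_self1_is_0 mod_mult_self4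
          mult.commute)
    then show ?thesis
      by (metis le0 mod_less_eq_dividend)
  next
    case False
    then have "(2::nat) ^ k < 2 ^ i"
      by simp
    \<comment> \<open>Here \<open>2 ^ k < 2 ^ i \<le> n \<le> 2 ^ k + 1\<close> leaves no gap; this
      occurs only for \<open>k = 0\<close>, \<open>i = 1\<close>, \<open>n = 2\<close>.\<close>
    then have "n = 2 ^ i"
      using assms by (auto simp del: power_strict_increasing_iff)
    then show ?thesis
      by simp
  qed
  then show ?thesis
    using assms(2) by (intro not_one_plus_monom_dvd_num_B)
qed

end
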